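(* Let $P=(V_P,E_P)$ be a simple connected undirected graph with $k\ge2$ vertices, and let $m\ge1$ and $\lambda\in[1,m]$ be integers. Let $(C_1,\dots,C_\alpha,S_1,\dots,S_\beta)$ be a fractional edge-cover decomposition of $P$ (with odd-length cycles $C_i$ and stars $S_j$), let $k_{\mathit{cycle}}$ be the total number of vertices in $C_1,\dots,C_\alpha$, and let $k_{\mathit{star}}$ be the total number of vertices in $S_1,\dots,S_\beta$. Then $$\mathit{polymat}_{\mathit{undir}}(m,\lambda,P)=\begin{cases} m\cdot\lambda^{k-2} & \text{if }\lambda\le\sqrt{m},\\[1mm] m^{\frac{k_{\mathit{cycle}}}{2}+\beta}\cdot\lambda^{k_{\mathit{star}}-2\beta} & \text{if }\lambda>\sqrt{m}.\end{cases}$$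
   Context: **Undirected polymatroid bound.** $$\mathit{polymat}_{\mathit{undir}}(m,\lambda,P)=2^{\max_h h(V_P)},$$ where $h$ ranges over all functions $h:2^{V_P}\to\mathbb{R}_{\ge0}$ such that $h(\emptyset)=0$; $h$ is monotone ($h(\mathcal{X})\le h(\mathcal{Y})$ for $\mathcal{X}\subseteq\mathcal{Y}\subseteq V_P$); $h$ is submodular ($h(\mathcal{X}\cup\mathcal{Y})+h(\mathcal{X}\cap\mathcal{Y})\le h(\mathcal{X})+h(\mathcal{Y})$ for all $\mathcal{X},\mathcal{Y}\subseteq V_P$); and for every edge $\{X,Y\}\in E_P$: $h(\{X,Y\})\le\log_2 m$, $h(\{X,Y\})-h(\{X\})\le\log_2\lambda$ and $h(\{X,Y\})-h(\{Y\})\le\log_2\lambda$. **Fractional edge cover number.** For an undirected graph $H$ without isolated vertices, a fractional edge cover is a function $w$ from the edges of $H$ to $[0,1]$ such that for each vertex $X$ the sum of $w(F)$ over edges $F\ni X$ is at least $1$; $\rho^*(H)$ is the minimum total weight $\sum_F w(F)$ over all fractional edge covers. **Fractional edge-cover decomposition.** A star is an undirected graph in which one vertex, the center, has an edge to every other vertex, and each non-center vertex has degree 1 (at least two vertices in total). A fractional edge-cover decomposition of $P$ is a tuple $(C_1,\dots,C_\alpha,S_1,\dots,S_\beta)$, with integers $\alpha,\beta\ge0$, of pairwise vertex-disjoint subgraphs of $P$ that together contain all vertices of $P$, such that each $C_i$ is an odd-length cycle, each $S_j$ is a star, and $\sum_{i=1}^\alpha\rho^*(C_i)+\sum_{j=1}^\beta\rho^*(S_j)=\rho^*(P)$.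 It is known that such a decomposition always exists. *)

theory Defs
  imports Complex_Main
begin

record 'a ugraph =
  verts :: "'a set"
  edges :: "'a set set"

definition simple_graph :: "'a ugraph \<Rightarrow> bool" where
  "simple_graph G \<longleftrightarrow>
     finite (verts G) \<and> (\<forall>e\<in>edges G. e \<subseteq> verts G \<and> card e = 2)"

definition connected_graph :: "'a ugraph \<Rightarrow> bool" where
  "connected_graph G \<longleftrightarrow>
     (\<forall>u\<in>verts G. \<forall>v\<in>verts G. (u, v) \<in> {(x, y). {x, y} \<in> edges G}\<^sup>*)"

definition is_subgraph :: "'a ugraph \<Rightarrow> 'a ugraph \<Rightarrow> bool" where
  "is_subgraph H G \<longleftrightarrow>
     simple_graph H \<and> verts H \<subseteq> verts G \<and> edges H \<subseteq> edges G"

text \<open>A set function on the power set of the vertices is represented by a total function;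
  only its values on subsets of the vertex set are constrained or used.\<close>

definition polymat_feasible :: "nat \<Rightarrow> nat \<Rightarrow> 'a ugraph \<Rightarrow> ('a set \<Rightarrow> real) \<Rightarrow> bool" where
  "polymat_feasible m lam G h \<longleftrightarrow>
     (\<forall>A. A \<subseteq> verts G \<longrightarrow> 0 \<le> h A) \<and>
     h {} = 0 \<and>
     (\<forall>A B. A \<subseteq> B \<and> B \<subseteq> verts G \<longrightarrow> h A \<le> h B) \<and>
     (\<forall>A B. A \<subseteq> verts G \<and> B \<subseteq> verts G \<longrightarrow> h (A \<union> B) + h (A \<inter> B) \<le> h A + h B) \<and>
     (\<forall>x y. {x, y} \<in> edges G \<longrightarrow>
        h {x, y} \<le> log 2 (real m) \<and>
        h {x, y} - h {x} \<le> log 2 (real lam) \<and>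
        h {x, y} - h {y} \<le> log 2 (real lam))"

text \<open>The bound is a maximum, not merely a supremum: \<open>GREATEST\<close> is determined only if some
  feasible function attains it.\<close>

definition polymat_undir :: "nat \<Rightarrow> nat \<Rightarrow> 'a ugraph \<Rightarrow> real" where
  "polymat_undir m lam G =
     2 powr (GREATEST r. \<exists>h. polymat_feasible m lam G h \<and> r = h (verts G))"

definition fractional_edge_cover :: "'a ugraph \<Rightarrow> ('a set \<Rightarrow> real) \<Rightarrow> bool" where
  "fractional_edge_cover G w \<longleftrightarrow>
     (\<forall>e\<in>edges G. 0 \<le> w e \<and> w e \<le> 1) \<and>
     (\<forall>x\<in>verts G. 1 \<le> (\<Sum>e\<in>{e\<in>edges G. x \<in> e}. w e))"

text \<open>As above, \<open>LEAST\<close> expresses an attained minimum.  It is meaningful for finite graphs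
  without isolated vertices; on other graphs there is no fractional edge cover.\<close>

definition fractional_edge_cover_number :: "'a ugraph \<Rightarrow> real" where
  "fractional_edge_cover_number G =
     (LEAST r. \<exists>w. fractional_edge_cover G w \<and> r = (\<Sum>e\<in>edges G. w e))"

definition odd_cycle :: "'a ugraph \<Rightarrow> bool" where
  "odd_cycle G \<longleftrightarrow>
     (\<exists>xs. distinct xs \<and> 3 \<le> length xs \<and> odd (length xs) \<and>
        verts G = set xs \<and>
        edges G = {{xs ! i, xs ! ((i + 1) mod length xs)} | i. i < length xs})"

definition degree :: "'a ugraph \<Rightarrow> 'a \<Rightarrow> nat" where
  "degree G x = card {e\<in>edges G. x \<in> e}"

definition star_graph :: "'a ugraph \<Rightarrow> bool" where
  "star_graph G \<longleftrightarrow>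
     simple_graph G \<and> 2 \<le> card (verts G) \<and>
     (\<exists>c\<in>verts G. \<forall>x\<in>verts G - {c}. {c, x} \<in> edges G \<and> degree G x = 1)"

definition fractional_edge_cover_decomposition ::
  "'a ugraph \<Rightarrow> 'a ugraph list \<Rightarrow> 'a ugraph list \<Rightarrow> bool" where
  "fractional_edge_cover_decomposition G Cs Ss \<longleftrightarrow>
     (\<forall>H\<in>set (Cs @ Ss). is_subgraph H G) \<and>
     (\<forall>i j. i < j \<and> j < length (Cs @ Ss) \<longrightarrow>
        verts ((Cs @ Ss) ! i) \<inter> verts ((Cs @ Ss) ! j) = {}) \<and>
     (\<Union>H\<in>set (Cs @ Ss). verts H) = verts G \<and>
     (\<forall>C\<in>set Cs. odd_cycle C) \<and>
     (\<forall>S\<in>set Ss. star_graph S) \<and>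
     (\<Sum>C\<leftarrow>Cs. fractional_edge_cover_number C) + (\<Sum>S\<leftarrow>Ss. fractional_edge_cover_number S)
       = fractional_edge_cover_number G"

end

theory Submission
  imports Defs
begin

text \<open>Write \<open>M = log 2 m\<close> and \<open>L = log 2 lam\<close>. Growing a connected graph from a single edge one
  vertex at a time shows \<open>h V \<le> M + (card V - 2) * L\<close>; a submodular function on a cycle
  is dominated by half the sum of its edge values. Applied to the whole graph, respectively to the
  parts of the decomposition, this gives the upper bounds.

  For \<open>2 * L \<le> M\<close> the bound is attained by \<open>card A * L + (M - 2 * L)\<close> on nonempty \<open>A\<close>.
  For \<open>2 * L > M\<close> it is attained by a modular function whose weights interpolate linearly
  between \<open>M - L\<close> and \<open>L\<close> along an optimal fractional vertex packing \<open>f\<close> (\<open>f x + f y \<le> 1\<close> on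
  edges); by duality such an \<open>f\<close> has total weight equal to the fractional edge cover number, which
  the decomposition bounds below by \<open>k_cycle / 2 + k_star - \<beta>\<close>.\<close>

section \<open>Hall's marriage theorem\<close>

text \<open>Rado's argument: as long as some \<open>A i\<close> has two elements, one of them can be deleted
  without destroying Hall's condition, since two violations would contradict the submodularity of
  \<open>J \<mapsto> card (\<Union>i\<in>J. A i)\<close>.\<close>

lemma hall_marriage:
  fixes A :: "'i \<Rightarrow> 'b set"
  assumes "finite I" and "\<And>i. i \<in> I \<Longrightarrow> finite (A i)"
    and "\<And>J. J \<subseteq> I \<Longrightarrow> card J \<le> card (\<Union>i\<in>J. A i)"
  shows "\<exists>f. inj_on f I \<and> (\<forall>i\<in>I. f i \<in> A i)"
  using assms(2,3)
proof (induction "\<Sum>i\<in>I. card (A i)" arbitrary: A rule: less_induct)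
  case less
  note fin = less.prems(1) and hall = less.prems(2)
  show ?case
  proof (cases "\<exists>i\<in>I. \<exists>x\<in>A i. \<exists>y\<in>A i. x \<noteq> y")
    case False
    have "A i \<noteq> {}" if "i \<in> I" for i
      using hall[of "{i}"] that by auto
    then have "\<forall>i\<in>I. \<exists>z. z \<in> A i"
      by blast
    then obtain f where f: "\<And>i. i \<in> I \<Longrightarrow> f i \<in> A i"
      by (auto dest!: bchoice)
    have A: "A i = {f i}" if "i \<in> I" for i
      using False f that by blast
    have "inj_on f I"
    proof (rule inj_onI, rule ccontr)
      \<comment> \<open>All the sets are singletons here, so two equal ones would violate Hall's
        condition on the pair \<open>{i, j}\<close>.\<close>
      fix i j assume ij: "i \<in> I" "j \<in> I" "f i = f j" "i \<noteq> j"
      then have "card {i, j} \<le> card (\<Union>l\<in>{i, j}. A l)"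
        by (intro hall) auto
      with ij show False by (simp add: A)
    qed
    with f show ?thesis by blast
  next
    case True
    then obtain i x y where i: "i \<in> I" and xy: "x \<in> A i" "y \<in> A i" "x \<noteq> y"
      by blast
    define B where "B z = A(i := A i - {z})" for z
    have finU: "finite (\<Union>j\<in>J. A j)" if "J \<subseteq> I" for J
      using that assms(1) fin by (auto intro: finite_subset)
    \<comment> \<open>A deletion that preserves Hall's condition lowers the total cardinality, so
      the induction hypothesis finishes.\<close>
    have shrink: ?thesis if z: "z \<in> A i" and h: "\<And>J. J \<subseteq> I \<Longrightarrow> card J \<le> card (\<Union>j\<in>J. B z j)" for z
    proof -
      have "(\<Sum>j\<in>I. card (B z j)) < (\<Sum>j\<in>I. card (A j))"
      proof (rule sum_strict_mono_ex1[OF assms(1)])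
        show "\<forall>j\<in>I. card (B z j) \<le> card (A j)"
          using fin by (auto simp: B_def intro!: card_mono)
        show "\<exists>j\<in>I. card (B z j) < card (A j)"
          using i z fin by (intro bexI[of _ i]) (auto simp: B_def simp del: card_Diff_singleton card_Diff_insert intro!: psubset_card_mono)
      qed
      moreover have "finite (B z j)" if "j \<in> I" for j
        using fin that by (auto simp: B_def)
      ultimately obtain f where "inj_on f I" "\<forall>j\<in>I. f j \<in> B z j"
        using less.hyps[of "B z"] h by blast
      then show ?thesis
        by (intro exI[of _ f]) (auto simp: B_def split: if_splits)
    qed
    \<comment> \<open>Deleting \<open>z\<close> changes only the set at \<open>i\<close>, so a
      violating \<open>J\<close> must contain \<open>i\<close>. Removing \<open>i\<close> from
      \<open>J\<close> turns the strict inequality into a weak one.\<close>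
    have violation: "\<exists>S\<subseteq>I - {i}. card ((\<Union>j\<in>S. A j) \<union> (A i - {z})) \<le> card S"
      if nz: "\<not> (\<forall>J\<subseteq>I. card J \<le> card (\<Union>j\<in>J. B z j))" for z
    proof -
      from nz obtain J where J: "J \<subseteq> I" "card (\<Union>j\<in>J. B z j) < card J"
        by (auto simp: not_le)
      have "i \<in> J"
      proof (rule ccontr)
        assume "i \<notin> J"
        then have "(\<Union>j\<in>J. B z j) = (\<Union>j\<in>J. A j)"
          by (auto simp: B_def)
        with J hall[of J] show False by simp
      qed
      then have "(\<Union>j\<in>J. B z j) = (\<Union>j\<in>J - {i}. A j) \<union> (A i - {z})"
        by (auto simp: B_def split: if_splits)
      moreover have "card J = Suc (card (J - {i}))"
        using \<open>i \<in> J\<close> J(1) assms(1) by (metis card.remove finite_subset)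
      ultimately show ?thesis
        using J by (intro exI[of _ "J - {i}"]) auto
    qed
    show ?thesis
    proof (rule ccontr)
      assume no: "\<not> ?thesis"
      obtain S where S: "S \<subseteq> I - {i}" "card ((\<Union>j\<in>S. A j) \<union> (A i - {x})) \<le> card S"
        using no shrink[of x] violation[of x] xy by blast
      obtain T where T: "T \<subseteq> I - {i}" "card ((\<Union>j\<in>T. A j) \<union> (A i - {y})) \<le> card T"
        using no shrink[of y] violation[of y] xy by blast
      let ?X = "(\<Union>j\<in>S. A j) \<union> (A i - {x})" and ?Y = "(\<Union>j\<in>T. A j) \<union> (A i - {y})"
      have ST: "S \<subseteq> I" "T \<subseteq> I" "finite S" "finite T" "i \<notin> S \<union> T"
        using S T assms(1) by (auto intro: finite_subset)
      have finXY: "finite ?X" "finite ?Y"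
        using finU ST fin i by auto
      \<comment> \<open>As \<open>x\<close> and \<open>y\<close> differ, \<open>?X\<close> and
        \<open>?Y\<close> together recover all of \<open>A i\<close>. The index \<open>i\<close>
        thus adds one to the bound for the union, while \<open>?X\<close> and \<open>?Y\<close>
        jointly have at most \<open>card S + card T\<close> elements counted with
        multiplicity.\<close>
      have "card (insert i (S \<union> T)) \<le> card (\<Union>j\<in>insert i (S \<union> T). A j)"
        using ST i by (intro hall) auto
      also have "(\<Union>j\<in>insert i (S \<union> T). A j) = ?X \<union> ?Y"
        using xy by auto
      finally have 1: "Suc (card (S \<union> T)) \<le> card (?X \<union> ?Y)"
        using ST by simp
      have "card (S \<inter> T) \<le> card (\<Union>j\<in>S \<inter> T. A j)"
        using ST by (intro hall) auto
      also have "\<dots> \<le> card (?X \<inter> ?Y)"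
        using finXY by (intro card_mono) auto
      finally have "card (S \<inter> T) \<le> card (?X \<inter> ?Y)" .
      with 1 S(2) T(2) card_Un_Int[OF finXY] card_Un_Int[OF ST(3,4)] show False
        by linarith
    qed
  qed
qed

section \<open>Duality of fractional edge covers and fractional vertex packings\<close>

text \<open>The feasible points of the linear program dual to fractional edge covers. The range from
  0 to 1 later keeps the interpolated weights between \<open>M - L\<close> and
  \<open>L\<close>.\<close>

definition fractional_packing :: "'a ugraph \<Rightarrow> ('a \<Rightarrow> real) \<Rightarrow> bool" where
  "fractional_packing G f \<longleftrightarrow>
     (\<forall>x\<in>verts G. 0 \<le> f x \<and> f x \<le> 1) \<and> (\<forall>x y. {x, y} \<in> edges G \<longrightarrow> f x + f y \<le> 1)"

lemma simple_graph_edgeE: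
  assumes "simple_graph G" "e \<in> edges G"
  obtains x y where "e = {x, y}" "x \<noteq> y" "x \<in> verts G" "y \<in> verts G"
  using assms unfolding simple_graph_def card_2_iff by fastforce

lemma simple_graph_edgeD:
  assumes "simple_graph G" "{x, y} \<in> edges G"
  shows "x \<in> verts G" "y \<in> verts G" "x \<noteq> y"
  using assms unfolding simple_graph_def by fastforce+

lemma simple_graph_finite:
  assumes "simple_graph G"
  shows "finite (verts G)" "finite (edges G)"
proof -
  show "finite (verts G)"
    using assms by (simp add: simple_graph_def)
  moreover have "edges G \<subseteq> Pow (verts G)"
    using assms by (auto simp: simple_graph_def)
  ultimately show "finite (edges G)"
    by (meson finite_Pow_iff finite_subset)
qed

text \<open>Weak duality: multiply the covering inequality at \<open>x\<close> by \<open>f x\<close>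
  and exchange the sums. Each edge then collects its weight times \<open>f x + f y\<close>, which is
  at most 1.\<close>

lemma packing_le_cover:
  assumes G: "simple_graph G" and f: "fractional_packing G f" and w: "fractional_edge_cover G w"
  shows "(\<Sum>x\<in>verts G. f x) \<le> (\<Sum>e\<in>edges G. w e)"
proof -
  note fin = simple_graph_finite[OF G]
  have "(\<Sum>x\<in>verts G. f x) \<le> (\<Sum>x\<in>verts G. f x * (\<Sum>e\<in>{e\<in>edges G. x \<in> e}. w e))"
  proof (rule sum_mono)
    fix x assume "x \<in> verts G"
    then have "0 \<le> f x" "1 \<le> (\<Sum>e\<in>{e\<in>edges G. x \<in> e}. w e)"
      using f w by (auto simp: fractional_packing_def fractional_edge_cover_def)
    then show "f x \<le> f x * (\<Sum>e\<in>{e\<in>edges G. x \<in> e}. w e)"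
      using mult_left_mono[of 1 _ "f x"] by fastforce
  qed
  also have "\<dots> = (\<Sum>x\<in>verts G. \<Sum>e\<in>{e\<in>edges G. x \<in> e}. f x * w e)"
    by (simp add: sum_distrib_left)
  also have "\<dots> = (\<Sum>e\<in>edges G. \<Sum>x\<in>{x\<in>verts G. x \<in> e}. f x * w e)"
    using fin by (rule sum.swap_restrict)
  also have "\<dots> \<le> (\<Sum>e\<in>edges G. w e)"
  proof (rule sum_mono)
    fix e assume e: "e \<in> edges G"
    then obtain x y where xy: "e = {x, y}" "x \<noteq> y" "x \<in> verts G" "y \<in> verts G"
      using simple_graph_edgeE[OF G] by metis
    then have "{z\<in>verts G. z \<in> e} = {x, y}"
      by auto
    then have "(\<Sum>x\<in>{x\<in>verts G. x \<in> e}. f x * w e) = (f x + f y) * w e"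
      using xy by (simp add: distrib_right)
    also have "\<dots> \<le> 1 * w e"
      using f w e xy by (intro mult_right_mono) (auto simp: fractional_packing_def fractional_edge_cover_def)
    finally show "(\<Sum>x\<in>{x\<in>verts G. x \<in> e}. f x * w e) \<le> w e" by simp
  qed
  finally show ?thesis .
qed

text \<open>Capping is harmless: an edge of weight at least 1 still covers its ends alone, and where
  there is none nothing changes. The cover built from a matching may use an edge several times and
  needs this.\<close>

lemma fractional_edge_cover_truncate:
  assumes fin: "finite (edges G)" and nonneg: "\<And>e. e \<in> edges G \<Longrightarrow> 0 \<le> w e"
    and cov: "\<And>x. x \<in> verts G \<Longrightarrow> 1 \<le> (\<Sum>e\<in>{e\<in>edges G. x \<in> e}. w e)"
  shows "fractional_edge_cover G (\<lambda>e. min 1 (w e))"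
  unfolding fractional_edge_cover_def
proof (intro conjI ballI)
  fix x assume x: "x \<in> verts G"
  let ?E = "{e\<in>edges G. x \<in> e}"
  show "1 \<le> (\<Sum>e\<in>?E. min 1 (w e))"
  proof (cases "\<exists>e\<in>?E. 1 \<le> w e")
    case True
    then obtain e where e: "e \<in> ?E" "1 \<le> w e" by blast
    then have "min 1 (w e) \<le> (\<Sum>e\<in>?E. min 1 (w e))"
      using fin nonneg by (intro member_le_sum) auto
    with e show ?thesis by simp
  next
    case False
    then have "(\<Sum>e\<in>?E. min 1 (w e)) = (\<Sum>e\<in>?E. w e)"
      by (intro sum.cong) (auto simp: not_le min_def)
    with cov[OF x] show ?thesis by simp
  qed
qed (use nonneg in auto)

text \<open>Koenig's theorem in the bipartite double cover. A set \<open>S\<close> of maximum deficiency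
  \<open>d = card S - card (N S)\<close> yields the half-integral packing; Hall's theorem with \<open>d\<close> dummy
  partners yields a matching that leaves at most \<open>d\<close> vertices on each side unmatched, and the
  matching extended by one edge for each unmatched vertex is a cover with the same weight.\<close>

lemma strong_duality:
  assumes G: "simple_graph G" and iso: "\<And>x. x \<in> verts G \<Longrightarrow> \<exists>y. {x, y} \<in> edges G"
  shows "\<exists>f w. fractional_packing G f \<and> fractional_edge_cover G w \<and>
    (\<Sum>e\<in>edges G. w e) = (\<Sum>x\<in>verts G. f x)"
proof -
  let ?V = "verts G" and ?E = "edges G"
  note fin = simple_graph_finite[OF G]
  define N where "N S = {y. \<exists>x\<in>S. {x, y} \<in> ?E}" for S
  have NV: "N S \<subseteq> ?V" for S
    using simple_graph_edgeD[OF G] by (auto simp: N_def)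
  have finN: "finite (N S)" for S
    using NV fin(1) finite_subset by blast
  define def where "def S = int (card S) - int (card (N S))" for S
  have "finite (def ` Pow ?V)" "def ` Pow ?V \<noteq> {}"
    using fin by auto
  then have "Max (def ` Pow ?V) \<in> def ` Pow ?V"
    by (rule Max_in)
  then obtain S where "S \<subseteq> ?V" "def S = Max (def ` Pow ?V)"
    by auto
  then have S: "S \<subseteq> ?V" "\<And>T. T \<subseteq> ?V \<Longrightarrow> def T \<le> def S"
    using fin by auto
  define d where "d = nat (def S)"
  have "def {} \<le> def S"
    by (rule S) simp
  then have d: "int d = def S"
    by (simp add: d_def def_def N_def)

  \<comment> \<open>In the double cover, \<open>S\<close> on the left and the complement of
    \<open>N S\<close> on the right form an independent set; \<open>f\<close> averages the two
    copies of each vertex.\<close>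
  define f :: "'a \<Rightarrow> real" where "f x = (of_bool (x \<in> S) + of_bool (x \<notin> N S)) / 2" for x
  have pack: "fractional_packing G f"
    unfolding fractional_packing_def
  proof (intro conjI ballI allI impI)
    fix x y assume "{x, y} \<in> ?E"
    then have "x \<in> S \<Longrightarrow> y \<in> N S" "y \<in> S \<Longrightarrow> x \<in> N S"
      by (auto simp: N_def insert_commute)
    then show "f x + f y \<le> 1"
      by (auto simp: f_def)
  qed (auto simp: f_def)
  have "(\<Sum>x\<in>?V. f x) = ((\<Sum>x\<in>?V. of_bool (x \<in> S)) + (\<Sum>x\<in>?V. of_bool (x \<notin> N S))) / 2"
    by (simp add: f_def sum.distrib sum_divide_distrib[symmetric])
  also have "(\<Sum>x\<in>?V. of_bool (x \<in> S)) = real (card S)"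
    using S(1) fin(1) by (simp add: Int_absorb1)
  also have "(\<Sum>x\<in>?V. of_bool (x \<notin> N S)) = real (card (?V - N S))"
    using fin(1) by (simp add: set_diff_eq Collect_conj_eq)
  also have "\<dots> = real (card ?V) - real (card (N S))"
    using NV fin(1) finN by (simp add: card_Diff_subset card_mono of_nat_diff)
  also have "real (card S) + (real (card ?V) - real (card (N S))) = real (card ?V) + real d"
    using d unfolding def_def by linarith
  finally have sumf: "(\<Sum>x\<in>?V. f x) = (real (card ?V) + real d) / 2" .

  \<comment> \<open>Neighbours are tagged \<open>Inl\<close>, dummies \<open>Inr\<close>. Every
    nonempty \<open>J\<close> sees all \<open>d\<close> dummies, which make up for its
    deficiency.\<close>
  define A where "A x = Inl ` N {x} \<union> Inr ` {..<d}" for x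
  have "\<exists>R. inj_on R ?V \<and> (\<forall>x\<in>?V. R x \<in> A x)"
  proof (rule hall_marriage[OF fin(1)])
    show "finite (A x)" for x
      using finN by (simp add: A_def)
    fix J assume J: "J \<subseteq> ?V"
    show "card J \<le> card (\<Union>x\<in>J. A x)"
    proof (cases "J = {}")
      case False
      then have "(\<Union>x\<in>J. A x) = Inl ` N J \<union> Inr ` {..<d}"
        by (auto simp: A_def N_def)
      moreover have "card (Inl ` N J \<union> Inr ` {..<d}) = card (N J) + d"
        using finN by (subst card_Un_disjoint) (auto simp: card_image)
      ultimately show ?thesis
        using S(2)[OF J] d by (simp add: def_def)
    qed simp
  qed
  then obtain R where R: "inj_on R ?V" "\<And>x. x \<in> ?V \<Longrightarrow> R x \<in> A x"
    by blast
  define U where "U = {x\<in>?V. \<exists>y. R x = Inl y}"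
  obtain nb where nb: "\<And>x. x \<in> ?V \<Longrightarrow> {x, nb x} \<in> ?E"
    using iso by metis
  \<comment> \<open>The matching partner where there is one, otherwise an arbitrary neighbour;
    injectivity holds on \<open>U\<close> only.\<close>
  define g where "g x = (if x \<in> U then projl (R x) else nb x)" for x
  have UV: "U \<subseteq> ?V"
    by (auto simp: U_def)
  have g: "{x, g x} \<in> ?E" if "x \<in> ?V" for x
    using R(2)[OF that] nb[OF that] by (auto simp: g_def U_def A_def N_def)
  have RU: "R x = Inl (g x)" if "x \<in> U" for x
    using that by (auto simp: g_def U_def)
  have injg: "inj_on g U"
    using R(1) RU UV by (metis (no_types, lifting) inj_on_def subsetD)
  have unmatched: "card (?V - U) \<le> d"
  proof -
    have "R ` (?V - U) \<subseteq> Inr ` {..<d}"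
      using R(2) by (fastforce simp: U_def A_def)
    then have "card (R ` (?V - U)) \<le> card (Inr ` {..<d} :: ('a + nat) set)"
      by (intro card_mono) auto
    then show ?thesis
      using R(1) by (simp add: card_image inj_on_diff)
  qed
  \<comment> \<open>The right-hand vertices missed by the matching. There are as many of them as
    unmatched left-hand vertices, hence at most \<open>d\<close>.\<close>
  define W where "W = ?V - g ` U"
  have gU: "g ` U \<subseteq> ?V"
    using g UV simple_graph_edgeD[OF G] by blast
  have "card W = card ?V - card U"
    unfolding W_def using gU fin(1) injg by (simp add: card_Diff_subset card_image finite_subset)
  then have cardW: "card W \<le> d"
    using unmatched UV fin(1) by (simp add: card_Diff_subset finite_subset)
  have WV: "W \<subseteq> ?V" by (auto simp: W_def)
  have finW: "finite W" using WV fin(1) by (rule finite_subset)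

  \<comment> \<open>Every left copy selects \<open>{x, g x}\<close> and every unmatched right copy
    selects \<open>{x, nb x}\<close>. Halving projects this cover of the double cover back to the
    graph.\<close>
  define w :: "'a set \<Rightarrow> real"
    where "w e = (card {x\<in>?V. {x, g x} = e} + card {x\<in>W. {x, nb x} = e}) / 2" for e
  have fibres: "(\<Sum>e\<in>T. w e) = (card X + card Y) / 2"
    if "finite T" "X = {x\<in>?V. {x, g x} \<in> T}" "Y = {x\<in>W. {x, nb x} \<in> T}" for T X Y
  proof -
    have "(\<Sum>e\<in>T. card {x\<in>?V. {x, g x} = e}) = (\<Sum>e\<in>T. card {x\<in>X. {x, g x} = e})"
      using that by (intro sum.cong arg_cong[where f = card]) auto
    also have "\<dots> = card X"
      using sum.group[of X T "\<lambda>x. {x, g x}" "\<lambda>_. 1::nat"] that fin by auto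
    finally have X: "(\<Sum>e\<in>T. card {x\<in>?V. {x, g x} = e}) = card X" .
    have "(\<Sum>e\<in>T. card {x\<in>W. {x, nb x} = e}) = (\<Sum>e\<in>T. card {x\<in>Y. {x, nb x} = e})"
      using that by (intro sum.cong arg_cong[where f = card]) auto
    also have "\<dots> = card Y"
      using sum.group[of Y T "\<lambda>x. {x, nb x}" "\<lambda>_. 1::nat"] that finW by auto
    finally have "(\<Sum>e\<in>T. card {x\<in>W. {x, nb x} = e}) = card Y" .
    with X show ?thesis
      by (simp add: w_def sum.distrib flip: sum_divide_distrib of_nat_sum)
  qed
  have cov: "1 \<le> (\<Sum>e\<in>{e\<in>?E. x \<in> e}. w e)" if x: "x \<in> ?V" for x
  proof -
    define X where "X = {z\<in>?V. {z, g z} \<in> {e\<in>?E. x \<in> e}}"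
    define Y where "Y = {z\<in>W. {z, nb z} \<in> {e\<in>?E. x \<in> e}}"
    have finXY: "finite X" "finite Y"
      using fin finW by (auto simp: X_def Y_def)
    have xX: "x \<in> X"
      using x g by (simp add: X_def)
    \<comment> \<open>The left copy of \<open>x\<close> is covered by its own edge. The right copy
      is covered through \<open>W\<close>, or by the edge of some \<open>z\<close> matched to
      \<open>x\<close>, where \<open>z\<close> differs from \<open>x\<close> because there are no
      loops.\<close>
    have "2 \<le> card X + card Y"
    proof (cases "x \<in> W")
      case True
      then have "x \<in> Y"
        using x nb by (simp add: Y_def)
      with xX finXY have "card X \<noteq> 0" "card Y \<noteq> 0"
        by auto
      then show ?thesis by linarith
    next
      case False
      then obtain z where z: "z \<in> U" "x = g z"
        using x by (auto simp: W_def)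
      then have "z \<in> X" "z \<noteq> x"
        using g UV simple_graph_edgeD(3)[OF G] by (auto simp: X_def)
      with xX have "card {x, z} \<le> card X"
        using finXY by (intro card_mono) auto
      with \<open>z \<noteq> x\<close> show ?thesis by simp
    qed
    moreover have "(\<Sum>e\<in>{e\<in>?E. x \<in> e}. w e) = (card X + card Y) / 2"
      using fin by (intro fibres) (auto simp: X_def Y_def)
    ultimately show ?thesis by simp
  qed
  have cover: "fractional_edge_cover G (\<lambda>e. min 1 (w e))"
    using fin cov by (intro fractional_edge_cover_truncate) (auto simp: w_def)
  have "(\<Sum>e\<in>?E. min 1 (w e)) \<le> (\<Sum>e\<in>?E. w e)"
    by (intro sum_mono) simp
  also have "\<dots> = (card ?V + card W) / 2"
    using fin g nb WV by (intro fibres) auto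
  also have "\<dots> \<le> (\<Sum>x\<in>?V. f x)"
    using cardW by (simp add: sumf)
  finally show ?thesis
    using packing_le_cover[OF G pack cover] pack cover by (meson order_antisym)
qed

text \<open>By weak duality the cover produced by strong duality is minimal, so the
  \<open>LEAST\<close> is attained and equals the packing's weight.\<close>

lemma fractional_edge_cover_number_packing:
  assumes G: "simple_graph G" and "\<And>x. x \<in> verts G \<Longrightarrow> \<exists>y. {x, y} \<in> edges G"
  obtains f where "fractional_packing G f" "(\<Sum>x\<in>verts G. f x) = fractional_edge_cover_number G"
proof -
  obtain f w where f: "fractional_packing G f" and w: "fractional_edge_cover G w"
    and eq: "(\<Sum>e\<in>edges G. w e) = (\<Sum>x\<in>verts G. f x)"
    using strong_duality[OF assms] by blast
  have "fractional_edge_cover_number G = (\<Sum>e\<in>edges G. w e)"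
    unfolding fractional_edge_cover_number_def
    using w eq packing_le_cover[OF G f] by (intro Least_equality) auto
  with f eq that show thesis by simp
qed

lemma packing_le_fractional_edge_cover_number:
  assumes G: "simple_graph G" and iso: "\<And>x. x \<in> verts G \<Longrightarrow> \<exists>y. {x, y} \<in> edges G"
    and f: "fractional_packing G f"
  shows "(\<Sum>x\<in>verts G. f x) \<le> fractional_edge_cover_number G"
proof -
  obtain f' w where f': "fractional_packing G f'" and w: "fractional_edge_cover G w"
    and eq: "(\<Sum>e\<in>edges G. w e) = (\<Sum>x\<in>verts G. f' x)"
    using strong_duality[OF G iso] by blast
  have "fractional_edge_cover_number G = (\<Sum>e\<in>edges G. w e)"
    unfolding fractional_edge_cover_number_def
    using w eq packing_le_cover[OF G f'] by (intro Least_equality) auto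
  then show ?thesis
    using packing_le_cover[OF G f w] by simp
qed

section \<open>Cycles, stars and connected graphs\<close>

text \<open>The constant 1/2 is a fractional packing.\<close>

lemma odd_cycle_cover_number:
  assumes G: "simple_graph G" and "odd_cycle G"
  shows "real (card (verts G)) / 2 \<le> fractional_edge_cover_number G"
proof -
  obtain xs where xs: "distinct xs" "3 \<le> length xs" "verts G = set xs"
    "edges G = {{xs ! i, xs ! ((i + 1) mod length xs)} | i. i < length xs}"
    using assms(2) unfolding odd_cycle_def by blast
  have "(\<Sum>x\<in>verts G. 1 / 2) \<le> fractional_edge_cover_number G"
  proof (rule packing_le_fractional_edge_cover_number[OF G])
    fix x assume "x \<in> verts G"
    then show "\<exists>y. {x, y} \<in> edges G"
      using xs by (auto simp: in_set_conv_nth)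
  qed (simp add: fractional_packing_def)
  then show ?thesis by simp
qed

text \<open>The indicator of the leaves is a fractional packing, because the degree condition rules
  out an edge between two leaves.\<close>

lemma star_cover_number:
  assumes "star_graph G"
  shows "real (card (verts G)) - 1 \<le> fractional_edge_cover_number G"
proof -
  have G: "simple_graph G" and two: "2 \<le> card (verts G)"
    using assms by (auto simp: star_graph_def)
  obtain c where c: "c \<in> verts G"
    "\<And>x. x \<in> verts G \<Longrightarrow> x \<noteq> c \<Longrightarrow> {c, x} \<in> edges G \<and> degree G x = 1"
    using assms by (auto simp: star_graph_def)
  note fin = simple_graph_finite[OF G]
  have "verts G \<noteq> {c}"
    using two by auto
  with c(1) obtain x0 where x0: "x0 \<in> verts G" "x0 \<noteq> c" by blast
  have "(\<Sum>x\<in>verts G. of_bool (x \<noteq> c)) \<le> fractional_edge_cover_number G"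
  proof (rule packing_le_fractional_edge_cover_number[OF G])
    fix x assume "x \<in> verts G"
    then show "\<exists>y. {x, y} \<in> edges G"
      using c x0 by (metis insert_commute)
  next
    show "fractional_packing G (\<lambda>x. of_bool (x \<noteq> c))"
      unfolding fractional_packing_def
    proof (intro conjI ballI allI impI)
      fix x y assume e: "{x, y} \<in> edges G"
      note xy = simple_graph_edgeD[OF G e]
      have "x = c \<or> y = c"
      proof (rule ccontr)
        assume n: "\<not> (x = c \<or> y = c)"
        then have "{{x, y}, {c, x}} \<subseteq> {e\<in>edges G. x \<in> e}"
          using c xy e by auto
        then have "card {{x, y}, {c, x}} \<le> degree G x"
          unfolding degree_def using fin by (intro card_mono) auto
        moreover have "{x, y} \<noteq> {c, x}"
          using n xy by (auto simp: doubleton_eq_iff)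
        ultimately show False
          using c(2)[of x] n xy by simp
      qed
      then show "of_bool (x \<noteq> c) + of_bool (y \<noteq> c) \<le> (1::real)"
        by auto
    qed auto
  qed
  moreover have "(\<Sum>x\<in>verts G. of_bool (x \<noteq> c) :: real) = real (card (verts G - {c}))"
    using fin by (simp add: set_diff_eq Collect_conj_eq)
  moreover have "real (card (verts G - {c})) = real (card (verts G)) - 1"
    using c(1) fin two by (simp add: of_nat_diff)
  ultimately show ?thesis by simp
qed

lemma star_connected:
  assumes "star_graph G"
  shows "connected_graph G"
proof -
  obtain c where c: "\<And>x. x \<in> verts G \<Longrightarrow> x \<noteq> c \<Longrightarrow> {c, x} \<in> edges G"
    using assms by (auto simp: star_graph_def)
  let ?R = "{(x, y). {x, y} \<in> edges G}"
  have "(x, c) \<in> ?R\<^sup>*" "(c, x) \<in> ?R\<^sup>*" if "x \<in> verts G" for x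
    using c[OF that] by (cases "x = c"; auto simp: insert_commute intro!: r_into_rtrancl)+
  then show ?thesis
    unfolding connected_graph_def by (meson rtrancl_trans)
qed

text \<open>A path from a vertex of \<open>A\<close> to one outside must leave \<open>A\<close>
  along some edge.\<close>

lemma connected_crossing_edge:
  assumes conn: "connected_graph G" and A: "A \<subseteq> verts G" "A \<noteq> {}" "A \<noteq> verts G"
  obtains x y where "x \<in> A" "y \<notin> A" "{x, y} \<in> edges G"
proof -
  obtain u v where uv: "u \<in> A" "v \<in> verts G" "v \<notin> A"
    using A by blast
  then have "(u, v) \<in> {(x, y). {x, y} \<in> edges G}\<^sup>*"
    using conn A by (auto simp: connected_graph_def)
  then have "v \<in> A \<or> (\<exists>x\<in>A. \<exists>y. y \<notin> A \<and> {x, y} \<in> edges G)"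
    by induction (use uv in auto)
  with uv that show thesis by blast
qed

lemma connected_no_isolated:
  assumes "connected_graph G" "2 \<le> card (verts G)" "x \<in> verts G"
  shows "\<exists>y. {x, y} \<in> edges G"
proof -
  have "{x} \<noteq> verts G"
    using assms(2) by (auto simp: eq_commute[of "{x}"])
  with assms show ?thesis
    using connected_crossing_edge[of G "{x}"] by auto
qed

section \<open>Upper bounds\<close>

lemma feasible_submodular:
  assumes "polymat_feasible m lam G h" "A \<subseteq> verts G" "B \<subseteq> verts G"
  shows "h (A \<union> B) + h (A \<inter> B) \<le> h A + h B"
  using assms by (simp add: polymat_feasible_def)

lemma feasible_subgraph:
  assumes "polymat_feasible m lam G h" "is_subgraph H G"
  shows "polymat_feasible m lam H h"
proof -
  have "verts H \<subseteq> verts G" "edges H \<subseteq> edges G"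
    using assms(2) by (auto simp: is_subgraph_def)
  with assms(1) show ?thesis
    unfolding polymat_feasible_def by (meson subset_eq order_trans)
qed

text \<open>The first edge costs at most \<open>log 2 m\<close>. A new vertex \<open>y\<close>
  adjacent to \<open>x\<close> in \<open>A\<close> costs at most \<open>log 2 lam\<close>:
  submodularity for \<open>A\<close> and \<open>{x, y}\<close> bounds the increase by
  \<open>h {x, y} - h {x}\<close>.\<close>

lemma connected_upper_bound:
  assumes G: "simple_graph G" and conn: "connected_graph G" and two: "2 \<le> card (verts G)"
    and h: "polymat_feasible m lam G h"
  shows "h (verts G) \<le> log 2 m + (real (card (verts G)) - 2) * log 2 lam"
proof -
  note fin = simple_graph_finite[OF G]
  have grow: "\<exists>A\<subseteq>verts G. card A = n \<and> h A \<le> log 2 m + (real n - 2) * log 2 lam"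
    if "2 \<le> n" "n \<le> card (verts G)" for n
    using that
  proof (induction n rule: nat_induct_at_least)
    case base
    obtain x where x: "x \<in> verts G"
      using two by fastforce
    then obtain y where e: "{x, y} \<in> edges G"
      using connected_no_isolated[OF conn two] by blast
    note xy = simple_graph_edgeD[OF G e]
    have "h {x, y} \<le> log 2 m"
      using h e by (simp add: polymat_feasible_def)
    with xy show ?case
      by (intro exI[of _ "{x, y}"]) simp
  next
    case (Suc n)
    then obtain A where A: "A \<subseteq> verts G" "card A = n" "h A \<le> log 2 m + (real n - 2) * log 2 lam"
      by auto
    have "A \<noteq> {}" "A \<noteq> verts G"
      using A Suc by auto
    then obtain x y where xy: "x \<in> A" "y \<notin> A" "{x, y} \<in> edges G"
      using connected_crossing_edge[OF conn A(1)] by blast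
    have y: "y \<in> verts G"
      using simple_graph_edgeD[OF G xy(3)] by simp
    have "h (A \<union> {x, y}) + h (A \<inter> {x, y}) \<le> h A + h {x, y}"
      using A xy y by (intro feasible_submodular[OF h]) auto
    moreover have "A \<union> {x, y} = insert y A" "A \<inter> {x, y} = {x}"
      using xy by auto
    moreover have "h {x, y} - h {x} \<le> log 2 lam"
      using h xy by (simp add: polymat_feasible_def)
    ultimately have "h (insert y A) \<le> log 2 m + (real (Suc n) - 2) * log 2 lam"
      using A(3) by (simp add: algebra_simps)
    moreover have "card (insert y A) = Suc n"
      using A xy fin finite_subset by fastforce
    ultimately show ?case
      using A y by (intro exI[of _ "insert y A"]) auto
  qed
  obtain A where "A \<subseteq> verts G" "card A = card (verts G)"
    "h A \<le> log 2 m + (real (card (verts G)) - 2) * log 2 lam"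
    using grow[OF two order_refl] by blast
  then show ?thesis
    using card_subset_eq[OF fin(1)] by metis
qed

text \<open>The greedy vertex of the base polytope of \<open>h\<close>.\<close>

lemma modular_minorant:
  fixes h :: "'a set \<Rightarrow> real"
  assumes "finite A" "h {} = 0"
    "\<And>X Y. X \<subseteq> A \<Longrightarrow> Y \<subseteq> A \<Longrightarrow> h (X \<union> Y) + h (X \<inter> Y) \<le> h X + h Y"
  shows "\<exists>d. (\<Sum>x\<in>A. d x) = h A \<and> (\<forall>B\<subseteq>A. (\<Sum>x\<in>B. d x) \<le> h B)"
  using assms
proof (induction A rule: finite_induct)
  case empty
  then show ?case by simp
next
  case (insert a A)
  then obtain d where d: "(\<Sum>x\<in>A. d x) = h A" "\<And>B. B \<subseteq> A \<Longrightarrow> (\<Sum>x\<in>B. d x) \<le> h B"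
    by (metis subset_insertI2)
  \<comment> \<open>The new vertex receives its marginal value. For \<open>B\<close> containing
    \<open>a\<close>, submodularity for \<open>A\<close> and \<open>B\<close> shows that this is at
    most the marginal value of \<open>a\<close> over \<open>B - {a}\<close>.\<close>
  define d' where "d' = d(a := h (insert a A) - h A)"
  have eq: "(\<Sum>x\<in>B. d' x) = (\<Sum>x\<in>B. d x)" if "a \<notin> B" for B
    using that by (intro sum.cong) (auto simp: d'_def)
  have "(\<Sum>x\<in>B. d' x) \<le> h B" if B: "B \<subseteq> insert a A" for B
  proof (cases "a \<in> B")
    case False
    then show ?thesis using d B eq by (metis subset_insert)
  next
    case True
    have "finite B" using B insert.hyps finite_subset by auto
    then have "(\<Sum>x\<in>B. d' x) = d' a + (\<Sum>x\<in>B - {a}. d' x)"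
      using True by (simp add: sum.remove)
    also have "\<dots> \<le> h (insert a A) - h A + h (B - {a})"
      using d(2)[of "B - {a}"] B by (simp add: eq) (auto simp: d'_def)
    finally have "(\<Sum>x\<in>B. d' x) \<le> h (insert a A) - h A + h (B - {a})" .
    moreover have "h (A \<union> B) + h (A \<inter> B) \<le> h A + h B"
      using B by (intro insert.prems) auto
    moreover have "A \<union> B = insert a A" "A \<inter> B = B - {a}"
      using B True insert.hyps by auto
    ultimately show ?thesis by simp
  qed
  moreover have "(\<Sum>x\<in>insert a A. d' x) = h (insert a A)"
    using insert.hyps d(1) eq by (simp add: d'_def)
  ultimately show ?case by blast
qed

lemma sum_cyclic_shift:
  fixes g :: "nat \<Rightarrow> real"
  assumes "0 < n"
  shows "(\<Sum>i<n. g ((i + 1) mod n)) = (\<Sum>i<n. g i)"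
proof -
  obtain k where n: "n = Suc k"
    using assms by (cases n) auto
  have "(\<Sum>i<Suc k. g ((i + 1) mod Suc k)) = (\<Sum>i<k. g ((i + 1) mod Suc k)) + g 0"
    by simp
  also have "(\<Sum>i<k. g ((i + 1) mod Suc k)) = (\<Sum>i<k. g (Suc i))"
    by (intro sum.cong) auto
  also have "\<dots> + g 0 = (\<Sum>i<Suc k. g i)"
    by (simp only: sum.lessThan_Suc_shift add.commute)
  finally show ?thesis using n by simp
qed

text \<open>Replace \<open>h\<close> by a modular minorant with the same total and sum it over the
  edges. Each vertex lies on two of them, so twice the total is at most \<open>log 2 m\<close> times
  the length.\<close>

lemma odd_cycle_upper_bound:
  assumes "simple_graph G" and "odd_cycle G" and h: "polymat_feasible m lam G h"
  shows "h (verts G) \<le> real (card (verts G)) / 2 * log 2 m"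
proof -
  obtain xs where xs: "distinct xs" "3 \<le> length xs" "verts G = set xs"
    "edges G = {{xs ! i, xs ! ((i + 1) mod length xs)} | i. i < length xs}"
    using assms(2) unfolding odd_cycle_def by blast
  let ?n = "length xs"
  obtain d where d: "(\<Sum>x\<in>verts G. d x) = h (verts G)"
    "\<And>B. B \<subseteq> verts G \<Longrightarrow> (\<Sum>x\<in>B. d x) \<le> h B"
    using modular_minorant[of "verts G" h] h simple_graph_finite[OF assms(1)]
    by (auto simp: polymat_feasible_def)
  have sum_eq: "(\<Sum>i<?n. d (xs ! i)) = h (verts G)"
    using sum.reindex_bij_betw[OF bij_betw_nth[OF xs(1) refl refl], of d] d(1) xs(3) by simp
  have "d (xs ! i) + d (xs ! ((i + 1) mod ?n)) \<le> log 2 m" if "i < ?n" for i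
  proof -
    let ?e = "{xs ! i, xs ! ((i + 1) mod ?n)}"
    have e: "?e \<in> edges G" using that xs(4) by auto
    have "d (xs ! i) + d (xs ! ((i + 1) mod ?n)) = (\<Sum>x\<in>?e. d x)"
      using simple_graph_edgeD(3)[OF assms(1) e] by simp
    also have "\<dots> \<le> h ?e"
      using simple_graph_edgeD[OF assms(1) e] by (intro d) auto
    also have "\<dots> \<le> log 2 m"
      using h e by (simp add: polymat_feasible_def)
    finally show ?thesis .
  qed
  then have "(\<Sum>i<?n. d (xs ! i) + d (xs ! ((i + 1) mod ?n))) \<le> (\<Sum>i<?n. log 2 m)"
    by (intro sum_mono) auto
  moreover have "(\<Sum>i<?n. d (xs ! ((i + 1) mod ?n))) = (\<Sum>i<?n. d (xs ! i))"
    using xs by (intro sum_cyclic_shift) auto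
  moreover have "card (verts G) = ?n"
    using xs by (simp add: distinct_card)
  ultimately show ?thesis
    by (simp add: sum.distrib sum_eq)
qed

section \<open>Decompositions\<close>

lemma sum_Union_list:
  fixes g :: "'b \<Rightarrow> 'c::comm_monoid_add"
  assumes "sorted_wrt (\<lambda>A B. A \<inter> B = {}) Xs" "\<And>X. X \<in> set Xs \<Longrightarrow> finite X"
  shows "(\<Sum>x\<in>\<Union>(set Xs). g x) = (\<Sum>X\<leftarrow>Xs. \<Sum>x\<in>X. g x)"
  using assms
proof (induction Xs)
  case (Cons X Xs)
  then have "X \<inter> \<Union>(set Xs) = {}"
    by auto
  with Cons show ?case
    by (simp add: sum.union_disjoint)
qed simp

text \<open>Submodularity gives this once the nonnegative values on the intersections are
  dropped.\<close>

lemma subadditive_Union_list: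
  assumes h: "polymat_feasible m lam G h" and "\<And>X. X \<in> set Xs \<Longrightarrow> X \<subseteq> verts G"
  shows "h (\<Union>(set Xs)) \<le> (\<Sum>X\<leftarrow>Xs. h X)"
  using assms(2)
proof (induction Xs)
  case Nil
  then show ?case using h by (simp add: polymat_feasible_def)
next
  case (Cons X Xs)
  then have sub: "X \<subseteq> verts G" "\<Union>(set Xs) \<subseteq> verts G"
    by auto
  have "0 \<le> h (X \<inter> \<Union>(set Xs))"
    using h sub unfolding polymat_feasible_def by (meson inf_le1 order_trans)
  with feasible_submodular[OF h sub] Cons show ?case
    by simp
qed

context
  fixes P :: "'a ugraph" and Cs Ss :: "'a ugraph list"
  assumes dec: "fractional_edge_cover_decomposition P Cs Ss"
begin

lemma decomposition_parts:
  shows "\<And>C. C \<in> set Cs \<Longrightarrow> is_subgraph C P \<and> simple_graph C \<and> odd_cycle C"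
    and "\<And>S. S \<in> set Ss \<Longrightarrow> is_subgraph S P \<and> simple_graph S \<and> star_graph S"
    and "\<Union>(set (map verts (Cs @ Ss))) = verts P"
  using dec by (auto simp: fractional_edge_cover_decomposition_def is_subgraph_def)

lemma decomposition_card:
  "card (verts P) = (\<Sum>C\<leftarrow>Cs. card (verts C)) + (\<Sum>S\<leftarrow>Ss. card (verts S))"
proof -
  have "sorted_wrt (\<lambda>A B. A \<inter> B = {}) (map verts (Cs @ Ss))"
    using dec by (simp add: fractional_edge_cover_decomposition_def sorted_wrt_iff_nth_less
      del: map_append)
  moreover have "finite X" if "X \<in> set (map verts (Cs @ Ss))" for X
    using that decomposition_parts simple_graph_finite by fastforce
  ultimately have "(\<Sum>x\<in>verts P. 1) = (\<Sum>X\<leftarrow>map verts (Cs @ Ss). \<Sum>x\<in>X. 1::nat)"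
    using sum_Union_list[of "map verts (Cs @ Ss)"] decomposition_parts(3) by metis
  then show ?thesis by (simp add: comp_def)
qed

text \<open>The packing bounds of the parts are added up; the equality of cover numbers in the
  decomposition transfers the result to \<open>P\<close>.\<close>

lemma decomposition_cover_number:
  "(\<Sum>C\<leftarrow>Cs. card (verts C)) / 2 + (\<Sum>S\<leftarrow>Ss. card (verts S)) - real (length Ss)
    \<le> fractional_edge_cover_number P"
proof -
  have "(\<Sum>C\<leftarrow>Cs. real (card (verts C)) / 2) \<le> (\<Sum>C\<leftarrow>Cs. fractional_edge_cover_number C)"
    using decomposition_parts odd_cycle_cover_number by (intro sum_list_mono) blast
  moreover have "(\<Sum>S\<leftarrow>Ss. real (card (verts S)) - 1) \<le> (\<Sum>S\<leftarrow>Ss. fractional_edge_cover_number S)"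
    using decomposition_parts star_cover_number by (intro sum_list_mono) blast
  moreover have "(\<Sum>C\<leftarrow>Cs. real (card (verts C)) / 2) = real (\<Sum>C\<leftarrow>Cs. card (verts C)) / 2"
    by (induction Cs) (auto simp: add_divide_distrib)
  moreover have "(\<Sum>S\<leftarrow>Ss. real (card (verts S)) - 1) = real (\<Sum>S\<leftarrow>Ss. card (verts S)) - real (length Ss)"
    by (induction Ss) auto
  ultimately show ?thesis
    using dec by (simp add: fractional_edge_cover_decomposition_def)
qed

text \<open>By subadditivity the parts are bounded separately: cycles by half their edge values,
  stars as connected graphs.\<close>

lemma decomposition_upper_bound:
  assumes h: "polymat_feasible m lam P h"
  shows "h (verts P) \<le> log 2 m * ((\<Sum>C\<leftarrow>Cs. card (verts C)) / 2 + length Ss)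
    + log 2 lam * (real (\<Sum>S\<leftarrow>Ss. card (verts S)) - 2 * length Ss)"
proof -
  have "h (verts P) \<le> (\<Sum>X\<leftarrow>map verts (Cs @ Ss). h X)"
    using subadditive_Union_list[OF h, of "map verts (Cs @ Ss)"] decomposition_parts
    by (metis Sup_upper)
  also have "\<dots> = (\<Sum>C\<leftarrow>Cs. h (verts C)) + (\<Sum>S\<leftarrow>Ss. h (verts S))"
    by (simp add: comp_def)
  also have "(\<Sum>C\<leftarrow>Cs. h (verts C)) \<le> (\<Sum>C\<leftarrow>Cs. real (card (verts C)) / 2 * log 2 m)"
    using decomposition_parts odd_cycle_upper_bound feasible_subgraph[OF h]
    by (intro sum_list_mono) blast
  also have "\<dots> = real (\<Sum>C\<leftarrow>Cs. card (verts C)) / 2 * log 2 m"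
    by (induction Cs) (auto simp: field_simps)
  also have "(\<Sum>S\<leftarrow>Ss. h (verts S)) \<le> (\<Sum>S\<leftarrow>Ss. log 2 m + (real (card (verts S)) - 2) * log 2 lam)"
  proof (rule sum_list_mono)
    fix S assume "S \<in> set Ss"
    then have S: "is_subgraph S P" "simple_graph S" "star_graph S"
      using decomposition_parts(2) by auto
    then show "h (verts S) \<le> log 2 m + (real (card (verts S)) - 2) * log 2 lam"
      by (intro connected_upper_bound star_connected feasible_subgraph[OF h])
        (auto simp: star_graph_def)
  qed
  also have "\<dots> = log 2 m * length Ss + log 2 lam * (real (\<Sum>S\<leftarrow>Ss. card (verts S)) - 2 * length Ss)"
    by (induction Ss) (auto simp: algebra_simps)
  finally show ?thesis by (simp add: algebra_simps)
qed

end

section \<open>Feasible functions\<close>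

text \<open>A multiple of the cardinality is modular, and a nonnegative constant on nonempty sets
  keeps monotonicity and submodularity. The constant makes an edge worth exactly
  \<open>log 2 m\<close> and its conditional values exactly \<open>log 2 lam\<close>.\<close>

lemma feasible_uniform:
  assumes G: "simple_graph G" and L: "0 \<le> log 2 lam" "2 * log 2 lam \<le> log 2 m"
  shows "polymat_feasible m lam G
    (\<lambda>A. real (card A) * log 2 lam + (if A = {} then 0 else log 2 m - 2 * log 2 lam))"
    (is "polymat_feasible m lam G ?h")
  unfolding polymat_feasible_def
proof (intro conjI allI impI)
  have fin: "finite A" if "A \<subseteq> verts G" for A
    using that simple_graph_finite[OF G] finite_subset by blast
  fix A B
  show "0 \<le> ?h A"
    using L by simp
  show "?h {} = 0"
    by simp
  show "?h A \<le> ?h B" if "A \<subseteq> B \<and> B \<subseteq> verts G"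
  proof -
    have "card A \<le> card B"
      using that fin by (intro card_mono) auto
    then have "real (card A) * log 2 lam \<le> real (card B) * log 2 lam"
      using L by (intro mult_right_mono) auto
    with that L show ?thesis by auto
  qed
  show "?h (A \<union> B) + ?h (A \<inter> B) \<le> ?h A + ?h B" if "A \<subseteq> verts G \<and> B \<subseteq> verts G"
  proof -
    have "real (card A) + real (card B) = real (card (A \<union> B)) + real (card (A \<inter> B))"
      using card_Un_Int[of A B] that fin by (metis of_nat_add)
    then have "real (card A) * log 2 lam + real (card B) * log 2 lam
      = real (card (A \<union> B)) * log 2 lam + real (card (A \<inter> B)) * log 2 lam"
      by (metis distrib_right)
    with L show ?thesis by auto
  qed
next
  fix x y assume "{x, y} \<in> edges G"
  then have "x \<noteq> y"
    using simple_graph_edgeD[OF G] by blast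
  then show "?h {x, y} \<le> log 2 m" "?h {x, y} - ?h {x} \<le> log 2 lam" "?h {x, y} - ?h {y} \<le> log 2 lam"
    by auto
qed

text \<open>For a modular function \<open>h {x, y} - h {x}\<close> is just \<open>c y\<close>, so
  the conditional constraints become bounds on single weights.\<close>

lemma feasible_modular:
  assumes G: "simple_graph G" and nonneg: "\<And>x. x \<in> verts G \<Longrightarrow> 0 \<le> c x"
    and le: "\<And>x. x \<in> verts G \<Longrightarrow> c x \<le> log 2 lam"
    and edge: "\<And>x y. {x, y} \<in> edges G \<Longrightarrow> c x + c y \<le> log 2 m"
  shows "polymat_feasible m lam G (\<lambda>A. \<Sum>x\<in>A. c x)"
  unfolding polymat_feasible_def
proof (intro conjI allI impI)
  have fin: "finite A" if "A \<subseteq> verts G" for A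
    using that simple_graph_finite[OF G] finite_subset by blast
  fix A B
  show "0 \<le> (\<Sum>x\<in>A. c x)" if "A \<subseteq> verts G"
    using that nonneg by (intro sum_nonneg) auto
  show "(\<Sum>x\<in>{}. c x) = 0"
    by simp
  show "(\<Sum>x\<in>A. c x) \<le> (\<Sum>x\<in>B. c x)" if "A \<subseteq> B \<and> B \<subseteq> verts G"
    using that nonneg fin by (intro sum_mono2) auto
  show "(\<Sum>x\<in>A \<union> B. c x) + (\<Sum>x\<in>A \<inter> B. c x) \<le> (\<Sum>x\<in>A. c x) + (\<Sum>x\<in>B. c x)"
    if "A \<subseteq> verts G \<and> B \<subseteq> verts G"
    using that fin by (simp add: sum.union_inter)
next
  fix x y assume e: "{x, y} \<in> edges G"
  note xy = simple_graph_edgeD[OF G e]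
  then show "(\<Sum>x\<in>{x, y}. c x) \<le> log 2 m" "(\<Sum>x\<in>{x, y}. c x) - (\<Sum>x\<in>{x}. c x) \<le> log 2 lam"
    "(\<Sum>x\<in>{x, y}. c x) - (\<Sum>x\<in>{y}. c x) \<le> log 2 lam"
    using edge[OF e] le by auto
qed

section \<open>Evaluation of the maximum in the two regimes\<close>

lemma polymat_undir_eqI:
  assumes "polymat_feasible m lam G h0" "r \<le> h0 (verts G)"
    and ub: "\<And>h. polymat_feasible m lam G h \<Longrightarrow> h (verts G) \<le> r"
  shows "polymat_undir m lam G = 2 powr r"
proof -
  have "h0 (verts G) = r"
    using assms ub[OF assms(1)] by simp
  then have "(GREATEST r. \<exists>h. polymat_feasible m lam G h \<and> r = h (verts G)) = r"
    using assms by (intro Greatest_equality) auto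
  then show ?thesis
    by (simp add: polymat_undir_def)
qed

theorem lemma5p1:
  fixes P :: "'a ugraph"
    and m lam k k_cycle k_star \<beta> :: nat
    and Cs Ss :: "'a ugraph list"
  assumes "simple_graph P" and "connected_graph P"
    and "k = card (verts P)" and "2 \<le> k"
    and "1 \<le> m" and "1 \<le> lam" and "lam \<le> m"
    and "fractional_edge_cover_decomposition P Cs Ss"
    and "k_cycle = (\<Sum>C\<leftarrow>Cs. card (verts C))"
    and "k_star = (\<Sum>S\<leftarrow>Ss. card (verts S))"
    and "\<beta> = length Ss"
  shows "polymat_undir m lam P =
    (if real lam \<le> sqrt (real m)
     then real m * real lam ^ (k - 2)
     else real m powr (real k_cycle / 2 + real \<beta>) * real lam powr (real k_star - 2 * real \<beta>))"
proof -
  note P = assms(1,2) and dec = assms(8)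
  define M L where "M = log 2 m" and "L = log 2 lam"
  have m: "real m = 2 powr M" and lam: "real lam = 2 powr L"
    using assms(5,6) by (simp_all add: M_def L_def)
  have L: "0 \<le> L" "L \<le> M"
    using assms(5-7) by (simp_all add: M_def L_def)
  have two: "2 \<le> card (verts P)"
    using assms(3,4) by simp
  have sqrt_iff: "real lam \<le> sqrt (real m) \<longleftrightarrow> 2 * L \<le> M"
    unfolding m lam by (simp add: powr_half_sqrt[symmetric] powr_powr mult.commute)
  show ?thesis
  proof (cases "real lam \<le> sqrt (real m)")
    case True
    let ?h = "\<lambda>A. real (card A) * L + (if A = {} then 0 else M - 2 * L)"
    have "verts P \<noteq> {}"
      using two by auto
    then have val: "?h (verts P) = M + (real k - 2) * L"
      using assms(3) by (simp add: algebra_simps)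
    have "polymat_undir m lam P = 2 powr (M + (real k - 2) * L)"
    proof (rule polymat_undir_eqI)
      show "polymat_feasible m lam P ?h"
        using feasible_uniform[OF P(1), of lam m] L True sqrt_iff unfolding M_def L_def by blast
      show "M + (real k - 2) * L \<le> ?h (verts P)"
        by (simp only: val)
      show "h (verts P) \<le> M + (real k - 2) * L" if "polymat_feasible m lam P h" for h
        using connected_upper_bound[OF P two that] assms(3) by (simp add: M_def L_def)
    qed
    \<comment> \<open>The truncated subtraction \<open>k - 2\<close> agrees with the real one since
      \<open>k\<close> is at least 2.\<close>
    also have "\<dots> = real m * real lam powr real (k - 2)"
      using assms(4) by (simp add: m lam powr_add powr_powr of_nat_diff mult.commute)
    also have "real lam powr real (k - 2) = real lam ^ (k - 2)"
      using assms(6) by (intro powr_realpow) simp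
    finally show ?thesis
      using True by simp
  next
    case False
    obtain f where f: "fractional_packing P f"
      "(\<Sum>x\<in>verts P. f x) = fractional_edge_cover_number P"
      using fractional_edge_cover_number_packing[OF P(1)] connected_no_isolated[OF P(2) two] by metis
    \<comment> \<open>The values 0, 1/2 and 1 of \<open>f\<close> become \<open>M - L\<close>,
      \<open>M / 2\<close> and \<open>L\<close>. As the slope \<open>2 * L - M\<close> is
      nonnegative, \<open>f x + f y <= 1\<close> yields \<open>c x + c y <= M\<close>.\<close>
    define c where "c x = M / 2 + (f x - 1 / 2) * (2 * L - M)" for x
    let ?r = "M * (k_cycle / 2 + \<beta>) + L * (real k_star - 2 * \<beta>)"
    have pos: "0 \<le> 2 * L - M"
      using False sqrt_iff by simp
    have "polymat_undir m lam P = 2 powr ?r"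
    proof (rule polymat_undir_eqI)
      show "polymat_feasible m lam P (\<lambda>A. \<Sum>x\<in>A. c x)"
      proof (rule feasible_modular[OF P(1)])
        fix x assume x: "x \<in> verts P"
        have "- 1 / 2 * (2 * L - M) \<le> (f x - 1 / 2) * (2 * L - M)"
          using f x pos by (intro mult_right_mono) (auto simp: fractional_packing_def)
        moreover have "M / 2 + - 1 / 2 * (2 * L - M) = M - L"
          by (simp add: field_simps)
        ultimately show "0 \<le> c x"
          using L by (simp add: c_def)
        have "(f x - 1 / 2) * (2 * L - M) \<le> 1 / 2 * (2 * L - M)"
          using f x pos by (intro mult_right_mono) (auto simp: fractional_packing_def)
        then show "c x \<le> log 2 lam"
          by (simp add: c_def L_def[symmetric])
      next
        fix x y assume "{x, y} \<in> edges P"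
        then have "(f x + f y - 1) * (2 * L - M) \<le> 0"
          using f pos by (intro mult_nonpos_nonneg) (auto simp: fractional_packing_def)
        then show "c x + c y \<le> log 2 m"
          by (simp add: c_def M_def[symmetric] algebra_simps)
      qed
      have k: "real (card (verts P)) = real k_cycle + real k_star"
        using decomposition_card[OF dec] assms(9,10) by simp
      \<comment> \<open>This writes \<open>?r\<close> as the total of \<open>c\<close> with
        \<open>k_cycle / 2 + k_star - \<beta>\<close> in place of the total of \<open>f\<close>. The
        cover number is at least that large, and the slope is nonnegative.\<close>
      have "?r = (k_cycle + k_star) * (M / 2)
        + (k_cycle / 2 + k_star - \<beta> - (k_cycle + k_star) / 2) * (2 * L - M)"
        by (simp add: field_simps)
      also have "\<dots> \<le> (k_cycle + k_star) * (M / 2)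
        + (fractional_edge_cover_number P - (k_cycle + k_star) / 2) * (2 * L - M)"
        using decomposition_cover_number[OF dec] assms(9-11) pos
        by (intro add_left_mono mult_right_mono) auto
      also have "\<dots> = (\<Sum>x\<in>verts P. c x)"
        by (simp add: c_def sum.distrib sum_subtractf k f(2)[symmetric] flip: sum_distrib_right)
      finally show "?r \<le> (\<Sum>x\<in>verts P. c x)" .
      show "h (verts P) \<le> ?r" if "polymat_feasible m lam P h" for h
        using decomposition_upper_bound[OF dec that] assms(9-11) by (simp add: M_def L_def)
    qed
    also have "\<dots> = real m powr (real k_cycle / 2 + real \<beta>) * real lam powr (real k_star - 2 * real \<beta>)"
      by (simp add: m lam powr_powr powr_add[of _ "M * _"] del: distrib_left_numeral)
    finally show ?thesis
      using False by simp
  qed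
qed

end
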